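(* Let $t,s$ be independent indeterminates and let $f_m(t,s)\in\mathbb{Q}(t,s)$ be the coefficients in $F_{t,s}(u)=\sum_{m\ge0}f_m(t,s)u^m$, so $f_0(t,s)=1$. For $m\ge1$, $$m\,f_m(t,s)=-2\sum_{\substack{1\le j\le m\\ j\text{ odd}}}\frac{1-s^j}{1-t^j}\,f_{m-j}(t,s).$$
   Context: $$F_{t,s}(u)=\exp\Big(-2\sum_{n\ge1,\ n\text{ odd}}\frac{1-s^n}{1-t^n}\frac{u^n}{n}\Big)\in\mathbb{Q}(t,s)[[u]].$$ *)

theory Defs
  imports "HOL-Computational_Algebra.Computational_Algebra"
begin

text \<open>
  The field \<open>\<rat>(t,s)\<close> is the fraction field of \<open>\<rat>[t][s]\<close>: the inner polynomial variable
  is \<open>t\<close>, the outer one is \<open>s\<close>.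
\<close>

type_synonym rat_ts = "rat poly poly fract"

definition t_var :: rat_ts where
  "t_var = to_fract [:[:0, 1:]:]"

definition s_var :: rat_ts where
  "s_var = to_fract [:0, 1:]"

text \<open>The library has no characteristic-zero instance for \<open>rat_ts\<close>, where \<open>1/n\<close> and
  \<open>1/n!\<close> must be genuine inverses.\<close>

instance fract :: ("{idom, ring_char_0}") field_char_0
proof
  show "inj (of_nat :: nat \<Rightarrow> 'a fract)"
    by (rule injI) (simp add: of_nat_fract eq_fract)
qed

definition F_exponent :: "rat_ts fps" where
  "F_exponent = fps_const (- 2) *
     Abs_fps (\<lambda>n. if odd n then (1 - s_var ^ n) / (1 - t_var ^ n) / of_nat n else 0)"

text \<open>\<open>F_exponent\<close> has constant term 0, so the composition below is the substitution of
  \<open>F_exponent\<close> into the exponential series.\<close>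

definition F_series :: "rat_ts fps" where
  "F_series = fps_exp 1 oo F_exponent"

definition f_coeff :: "nat \<Rightarrow> rat_ts" where
  "f_coeff m = fps_nth F_series m"

end

theory Submission
  imports Defs
begin

text \<open>
  The recursion is the coefficientwise form of the logarithmic derivative: if \<open>F = exp(E)\<close> with
  \<open>E\<close> of zero constant term, then \<open>u F' = (u E') F\<close>. The coefficient of \<open>u\<^sup>j\<close> in \<open>u E'\<close> is
  \<open>j\<close> times that of \<open>E\<close>, which for the exponent here is \<open>- 2 (1 - s\<^sup>j) / (1 - t\<^sup>j)\<close>
  for odd \<open>j\<close> and \<open>0\<close> for even \<open>j\<close>.
\<close>

lemma fps_exp_compose_nth_rec:
  fixes E :: "'a::field_char_0 fps"
  assumes "fps_nth E 0 = 0"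
  shows "of_nat m * fps_nth (fps_exp 1 oo E) m =
    (\<Sum>j=0..m. of_nat j * fps_nth E j * fps_nth (fps_exp 1 oo E) (m - j))"
proof -
  let ?F = "fps_exp 1 oo E"
  have nth: "fps_nth (fps_X * fps_deriv G) n = of_nat n * fps_nth G n" for G :: "'a fps" and n
    by (cases n) simp_all
  have "fps_deriv ?F = ?F * fps_deriv E"
    using assms by (simp add: fps_compose_deriv)
  then have "fps_X * fps_deriv ?F = (fps_X * fps_deriv E) * ?F"
    by (simp only: mult_ac)
  then have "fps_nth (fps_X * fps_deriv ?F) m = fps_nth ((fps_X * fps_deriv E) * ?F) m"
    by (rule arg_cong)
  then show ?thesis
    unfolding nth fps_mult_nth[of "fps_X * fps_deriv E"] .
qed

lemma of_nat_mult_F_exponent_nth: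
  "of_nat j * fps_nth F_exponent j =
    (if odd j then - 2 * ((1 - s_var ^ j) / (1 - t_var ^ j)) else 0)"
proof (cases "odd j")
  case True
  then have "(of_nat j :: rat_ts) \<noteq> 0"
    by (auto simp: odd_pos)
  then show ?thesis
    using True by (simp add: F_exponent_def)
qed (simp add: F_exponent_def)

theorem proposition3p4:
  shows "f_coeff 0 = 1 \<and>
    (\<forall>m\<ge>1. of_nat m * f_coeff m =
      - 2 * (\<Sum>j | 1 \<le> j \<and> j \<le> m \<and> odd j.
               (1 - s_var ^ j) / (1 - t_var ^ j) * f_coeff (m - j)))"
proof (intro conjI allI impI)
  show "f_coeff 0 = 1"
    by (simp add: f_coeff_def F_series_def)
next
  fix m :: nat
  let ?c = "\<lambda>j. (1 - s_var ^ j) / (1 - t_var ^ j)"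
  have "fps_nth F_exponent 0 = 0"
    by (simp add: F_exponent_def)
  then have "of_nat m * f_coeff m =
      (\<Sum>j=0..m. of_nat j * fps_nth F_exponent j * f_coeff (m - j))"
    unfolding f_coeff_def F_series_def by (rule fps_exp_compose_nth_rec)
  also have "\<dots> = (\<Sum>j=0..m. if odd j then - 2 * (?c j * f_coeff (m - j)) else 0)"
    unfolding of_nat_mult_F_exponent_nth
    by (rule sum.cong) (auto simp only: mult.assoc mult_zero_left split: if_split)
  also have "\<dots> = (\<Sum>j | j \<in> {0..m} \<and> odd j. - 2 * (?c j * f_coeff (m - j)))"
    by (rule sum.inter_filter[symmetric]) simp
  also have "{j. j \<in> {0..m} \<and> odd j} = {j. 1 \<le> j \<and> j \<le> m \<and> odd j}"
    by (auto simp: Suc_le_eq odd_pos)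
  finally show "of_nat m * f_coeff m =
      - 2 * (\<Sum>j | 1 \<le> j \<and> j \<le> m \<and> odd j. ?c j * f_coeff (m - j))"
    by (simp only: sum_distrib_left)
qed

end
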